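(* Let $\mathcal P=\prod_{i\in\mathcal N}[0,\bar p_i]$ with $0<\bar p_i<\infty$, and let $\bar p=\max_{i}\bar p_i$. Consider the consumer game of the context, with $b_i>0$ for all $i$, and assume that each $h_i:\mathcal X_i\to\mathbb R$ is twice differentiable and continuously differentiable, and $\mu_i$-strongly convex with $\mu_i>0$. Assume that one of the following holds: (1) for all $i$, $\mathcal X_i\subseteq\mathbb R_+$ is nonempty, convex and compact; or (2) for all $i$, $\mathcal X_i\subseteq\mathbb R_+$ is nonempty, convex and closed and $\lim_{x_i\in\mathcal X_i,|x_i|\to\infty}h_i(x_i)/|x_i|=+\infty$. Assume that $\mathbf G$ is entry-wise non-negative and that $\rho(\delta\,\mathbf D^{-1}\mathbf G)<1$, where $\mathbf D=\operatorname{diag}(\mu_1,\dots,\mu_N)$ (so that for every $\mathbf p\in\mathcal P$ there is a unique Nash equilibrium $\mathbf x^\star(\mathbf p)\in\mathcal X$). Assume further that $\mathbf x^\star(\mathbf p)\in\mathring{\mathcal X}$ for all $\mathbf p\in\mathcal P$, and that $\mathbf p^\star\in\mathcal P$ is a local maximizer, lying in the interior of $\mathcal P$, of the revenue $r(\mathbf p)=\mathbf p^\top\mathbf x^\star(\mathbf p)$. Let $i\in\mathcal N$ be such that the $i$-th row of $\mathbf G$ is zero. Then $$V_i<\frac{\phi_i^{-1}(a_i)}{\bar p\,b_i}\quad\Longrightarrow\quad p_i^\star\ \ge\ \frac{a_i-\phi_i(\bar p\,b_iV_i)}{b_i}\ >\ 0 .$$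
   Context: Consumer game: $\mathcal N=\{1,\dots,N\}$, $\delta\ge0$, $\mathbf G=(g_{ij})\in\mathbb R^{N\times N}$ with $g_{ii}=0$, $a_i\in\mathbb R$, $\mathcal X=\prod_i\mathcal X_i$ with interior $\mathring{\mathcal X}$. Given prices $\mathbf p$, consumer $i$ chooses $x_i\in\mathcal X_i$ to maximize $(a_i-b_ip_i+\delta\sum_{j}g_{ij}x_j)x_i-h_i(x_i)$; a Nash equilibrium $\mathbf x^\star(\mathbf p)$ is a profile of mutual best responses. Strong convexity: $h_i(y)\ge h_i(x)+h_i'(x)(y-x)+\frac{\mu_i}{2}|y-x|^2$ for all $x,y\in\mathcal X_i$. Write $\phi_i=h_i'$ (strictly increasing, so $\phi_i^{-1}$ is its inverse on its range), $D_{\boldsymbol\phi}(\mathbf x)=\operatorname{diag}(\phi_1'(x_1),\dots,\phi_N'(x_N))$, and $\mathbf J(\mathbf x)=D_{\boldsymbol\phi}(\mathbf x)-\delta\mathbf G$. The intrinsic influential value of consumer $i$ is $V_i=\sup_{\mathbf x\in\mathcal X}[\mathbf 1^\top\mathbf J(\mathbf x)^{-1}]_i$, where $\mathbf 1$ is the all-ones vector (when each $h_i$ is twice differentiable and $\mu_i$-strongly convex with $\mu_i>0$, $\mathbf G$ is entry-wise non-negative, and $\rho(\delta\,\mathbf D^{-1}\mathbf G)<1$ with $\mathbf D=\operatorname{diag}(\mu_1,\dots,\mu_N)$, the matrix $\mathbf J(\mathbf x)$ is invertible for every $\mathbf x\in\mathcal X$). $\rho$ is the spectral radius. Derivatives at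 endpoints of an interval are one-sided. *)

theory Defs
  imports "HOL-Analysis.Analysis"
begin

definition diagonal_matrix :: "real^'n \<Rightarrow> real^'n^'n" where
  "diagonal_matrix d = (\<chi> i j. if i = j then d $ i else 0)"

text \<open>Complex eigenvalues are needed: the spectral radius of a real matrix ranges over all of them.\<close>

definition complex_spectrum :: "real^'n^'n \<Rightarrow> complex set" where
  "complex_spectrum A =
     {ev. \<exists>v. v \<noteq> 0 \<and> map_matrix complex_of_real A *v v = ev *s v}"

definition matrix_spectral_radius :: "real^'n^'n \<Rightarrow> real" where
  "matrix_spectral_radius A = Max (cmod ` complex_spectrum A)"

text \<open>The derivative of \<open>f\<close> relative to \<open>S\<close>. At an endpoint of an interval it is one-sided.
  If \<open>S\<close> is an interval with more than one point and \<open>f\<close> is differentiable on \<open>S\<close>, it is the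
  unique derivative; on other sets its value is arbitrary.\<close>

definition deriv_within :: "real set \<Rightarrow> (real \<Rightarrow> real) \<Rightarrow> real \<Rightarrow> real" where
  "deriv_within S f x = vector_derivative f (at x within S)"

definition strongly_convex_on :: "real set \<Rightarrow> real \<Rightarrow> (real \<Rightarrow> real) \<Rightarrow> bool" where
  "strongly_convex_on S m f \<longleftrightarrow>
     (\<forall>x\<in>S. \<forall>y\<in>S. f y \<ge> f x + deriv_within S f x * (y - x) + m / 2 * \<bar>y - x\<bar>\<^sup>2)"

definition profiles :: "('n \<Rightarrow> real set) \<Rightarrow> (real^'n) set" where
  "profiles X = {x. \<forall>i. x $ i \<in> X i}"

definition payoff ::
  "real \<Rightarrow> real^'n^'n \<Rightarrow> real^'n \<Rightarrow> real^'n \<Rightarrow> ('n \<Rightarrow> real \<Rightarrow> real) \<Rightarrow> real^'n \<Rightarrow> 'n \<Rightarrow> real^'n \<Rightarrow> real"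
where
  "payoff \<delta> G a b h p i x =
     (a $ i - b $ i * p $ i + \<delta> * (\<Sum>j\<in>UNIV. G $ i $ j * x $ j)) * x $ i - h i (x $ i)"

definition nash_equilibrium ::
  "real \<Rightarrow> real^'n^'n \<Rightarrow> real^'n \<Rightarrow> real^'n \<Rightarrow> ('n \<Rightarrow> real set) \<Rightarrow> ('n \<Rightarrow> real \<Rightarrow> real) \<Rightarrow>
   real^'n \<Rightarrow> real^'n \<Rightarrow> bool"
where
  "nash_equilibrium \<delta> G a b X h p x \<longleftrightarrow>
     x \<in> profiles X \<and>
     (\<forall>i. \<forall>y\<in>X i.
        payoff \<delta> G a b h p i (\<chi> j. if j = i then y else x $ j) \<le> payoff \<delta> G a b h p i x)"

definition equilibrium ::
  "real \<Rightarrow> real^'n^'n \<Rightarrow> real^'n \<Rightarrow> real^'n \<Rightarrow> ('n \<Rightarrow> real set) \<Rightarrow> ('n \<Rightarrow> real \<Rightarrow> real) \<Rightarrow>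
   real^'n \<Rightarrow> real^'n"
where
  "equilibrium \<delta> G a b X h p = (THE x. nash_equilibrium \<delta> G a b X h p x)"

definition revenue ::
  "real \<Rightarrow> real^'n^'n \<Rightarrow> real^'n \<Rightarrow> real^'n \<Rightarrow> ('n \<Rightarrow> real set) \<Rightarrow> ('n \<Rightarrow> real \<Rightarrow> real) \<Rightarrow>
   real^'n \<Rightarrow> real"
where
  "revenue \<delta> G a b X h p = p \<bullet> equilibrium \<delta> G a b X h p"

definition local_maximizer_on :: "(real^'n) set \<Rightarrow> (real^'n \<Rightarrow> real) \<Rightarrow> real^'n \<Rightarrow> bool" where
  "local_maximizer_on P r p \<longleftrightarrow>
     p \<in> P \<and> (\<exists>e>0. \<forall>q\<in>P. dist q p < e \<longrightarrow> r q \<le> r p)"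

definition phi :: "('n \<Rightarrow> real set) \<Rightarrow> ('n \<Rightarrow> real \<Rightarrow> real) \<Rightarrow> 'n \<Rightarrow> real \<Rightarrow> real" where
  "phi X h i = deriv_within (X i) (h i)"

definition phi_inv :: "('n \<Rightarrow> real set) \<Rightarrow> ('n \<Rightarrow> real \<Rightarrow> real) \<Rightarrow> 'n \<Rightarrow> real \<Rightarrow> real" where
  "phi_inv X h i = inv_into (X i) (phi X h i)"

definition J_matrix ::
  "real \<Rightarrow> real^'n^'n \<Rightarrow> ('n \<Rightarrow> real set) \<Rightarrow> ('n \<Rightarrow> real \<Rightarrow> real) \<Rightarrow> real^'n \<Rightarrow> real^'n^'n"
where
  "J_matrix \<delta> G X h x =
     diagonal_matrix (\<chi> i. deriv_within (X i) (phi X h i) (x $ i)) - \<delta> *\<^sub>R G"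

text \<open>The supremum is taken in the reals. Under the standing assumptions the values are
  bounded above, by the entries of the row vector \<open>vec 1 v* matrix_inv (D - \<delta> *\<^sub>R G)\<close>, with \<open>D\<close>
  the diagonal matrix of the strong convexity constants.\<close>

definition influential_value ::
  "real \<Rightarrow> real^'n^'n \<Rightarrow> ('n \<Rightarrow> real set) \<Rightarrow> ('n \<Rightarrow> real \<Rightarrow> real) \<Rightarrow> 'n \<Rightarrow> real"
where
  "influential_value \<delta> G X h i =
     (SUP x\<in>profiles X. (vec 1 v* matrix_inv (J_matrix \<delta> G X h x)) $ i)"

end

(* A real eigenvalue at least 1 of the non-negative matrix M = delta D^-1 G is excluded, so
   (I - M) v = 1 has a positive solution v. The same weights v make D - delta G and every Jacobian
   J(x) diagonally dominant with non-positive off-diagonal entries, hence invertible with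
   non-negative inverse. By strong convexity best replies are Lipschitz, so they map the box
   [-C v, C v] into itself for large C, and Brouwer's theorem gives an equilibrium; dominance makes
   it unique.

   Raising only the price p_i by t > 0 from the optimum p moves the equilibrium by
   - b_i t J(z)^-1 e_i for some profile z (mean value theorem). Since the revenue does not increase,
   the new demand satisfies x_i <= b_i p J(z)^-1 e_i <= pbar b_i V_i. As row i of G vanishes,
   phi_i(x_i) = a_i - b_i (p_i + t), and the bound follows as t tends to 0. At the price 0 the same
   equation shows that a_i lies in the range of phi_i. *)

theory Submission
  imports Defs
begin

section \<open>Complex spectrum of a real matrix\<close>

text \<open>Applying \<open>A\<close> to the relation and multiplying it by the new eigenvalue
  \<open>x\<close> give two relations. Their difference loses \<open>w x\<close> and has the
  coefficients \<open>c s * (s - x)\<close>, so the induction hypothesis applies. Indexing by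
  eigenvalues keeps the factors \<open>s - x\<close> nonzero.\<close>

lemma eigenvectors_independent_coeffs:
  fixes A :: "complex^'n^'n"
  assumes "finite S" and "\<And>s. s \<in> S \<Longrightarrow> w s \<noteq> 0 \<and> A *v w s = s *s w s"
    and "(\<Sum>s\<in>S. c s *s w s) = 0"
  shows "\<forall>s\<in>S. c s = 0"
  using assms
proof (induction S arbitrary: c rule: finite_induct)
  case empty
  then show ?case by simp
next
  case (insert x S)
  have sum0: "c x *s w x + (\<Sum>s\<in>S. c s *s w s) = 0"
    using insert.prems(2) insert.hyps by simp
  have "A *v (c x *s w x + (\<Sum>s\<in>S. c s *s w s)) = 0"
    unfolding sum0 by simp
  then have "c x *s (x *s w x) + (\<Sum>s\<in>S. c s *s (s *s w s)) = 0"
    using insert.prems(1)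
    by (simp add: matrix_vector_right_distrib vec.sum vec.scale del: vector_smult_assoc)
  moreover have "x *s (c x *s w x + (\<Sum>s\<in>S. c s *s w s)) = 0"
    unfolding sum0 by simp
  ultimately have "(\<Sum>s\<in>S. c s *s (s *s w s)) = (\<Sum>s\<in>S. x *s (c s *s w s))"
    by (simp add: vec.scale_right_distrib vec.scale_sum_right mult.commute)
       (metis add_left_cancel)
  then have "(\<Sum>s\<in>S. (c s * (s - x)) *s w s) = 0"
    by (simp add: algebra_simps vec.scale_left_diff_distrib sum_subtractf)
  then have "\<forall>s\<in>S. c s * (s - x) = 0"
    using insert.prems(1) by (intro insert.IH) simp_all
  then have cS: "\<forall>s\<in>S. c s = 0"
    using insert.hyps(2) by auto
  then have "c x *s w x = 0"
    using sum0 by simp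
  then show ?case
    using cS insert.prems(1) by simp
qed

text \<open>One eigenvector chosen per eigenvalue yields an independent family in a
  finite-dimensional space. Finiteness is what gives the \<open>Max\<close> in
  \<open>matrix_spectral_radius\<close> its meaning.\<close>

lemma finite_complex_spectrum: "finite (complex_spectrum (A :: real^'n^'n))"
proof -
  let ?A = "map_matrix complex_of_real A"
  let ?S = "complex_spectrum A"
  obtain w where w: "\<And>s. s \<in> ?S \<Longrightarrow> w s \<noteq> 0 \<and> ?A *v w s = s *s w s"
  proof -
    have "\<forall>s\<in>?S. \<exists>v. v \<noteq> 0 \<and> ?A *v v = s *s v"
      by (simp add: complex_spectrum_def)
    then show ?thesis using that by (metis (no_types, lifting))
  qed
  have inj: "inj_on w ?S"
    by (rule inj_onI) (metis w vec.scale_right_imp_eq)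
  have "vec.independent (w ` ?S)"
    unfolding vec.independent_explicit_finite_subsets
  proof (intro allI impI ballI)
    fix T u x
    assume T: "T \<subseteq> w ` ?S" "finite T" and u: "(\<Sum>v\<in>T. u v *s v) = 0" and x: "x \<in> T"
    obtain S where S: "S \<subseteq> ?S" "finite S" "T = w ` S"
      using finite_subset_image T by metis
    have "(\<Sum>s\<in>S. u (w s) *s w s) = 0"
      using u sum.reindex[OF inj_on_subset[OF inj S(1)], of "\<lambda>v. u v *s v"] S(3) by simp
    then have "\<forall>s\<in>S. u (w s) = 0"
      using w S by (intro eigenvectors_independent_coeffs[of S w ?A]) auto
    then show "u x = 0"
      using x S(3) by auto
  qed
  then have "finite (w ` ?S)"
    by (rule vec.finiteI_independent)
  then show ?thesis
    using inj by (simp add: finite_image_iff)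
qed

text \<open>A real eigenvector is also an eigenvector of the complexified matrix. This is how the
  bound on the spectral radius enters: it excludes real eigenvalues of size at least 1.\<close>

lemma real_eigenvalue_le_spectral_radius:
  fixes A :: "real^'n^'n"
  assumes "A *v x = c *s x" and "x \<noteq> 0"
  shows "c \<le> matrix_spectral_radius A"
proof -
  let ?x = "\<chi> k. complex_of_real (x $ k)"
  have "map_matrix complex_of_real A *v ?x = complex_of_real c *s ?x"
  proof (rule vec_eq_iff[THEN iffD2], rule allI)
    fix k
    have "(A *v x) $ k = c * x $ k"
      using assms(1) by simp
    then have "complex_of_real (\<Sum>l\<in>UNIV. A $ k $ l * x $ l) = of_real (c * x $ k)"
      by (simp add: matrix_vector_mult_def)
    then show "(map_matrix complex_of_real A *v ?x) $ k = (complex_of_real c *s ?x) $ k"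
      by (simp add: matrix_vector_mult_def map_matrix_def)
  qed
  moreover have "?x \<noteq> 0"
    using assms(2) by (auto simp: vec_eq_iff)
  ultimately have "complex_of_real c \<in> complex_spectrum A"
    by (auto simp: complex_spectrum_def)
  then have "cmod (complex_of_real c) \<le> matrix_spectral_radius A"
    unfolding matrix_spectral_radius_def
    by (intro Max_ge finite_imageI finite_complex_spectrum imageI)
  then show ?thesis by simp
qed

section \<open>Matrices with non-positive off-diagonal entries and weighted diagonal
  dominance\<close>

text \<open>A minimum principle: let \<open>k0\<close> minimize the ratio
  \<open>x $ l / v $ l\<close>. Since off-diagonal entries are non-positive, row \<open>k0\<close>
  of \<open>A *v x\<close> is at most the minimal ratio times row \<open>k0\<close> of
  \<open>A *v v\<close>, so a negative ratio contradicts the sign of \<open>A *v x\<close>.\<close>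

lemma z_matrix_nonneg:
  fixes A :: "real^'n^'n"
  assumes off: "\<And>k l. k \<noteq> l \<Longrightarrow> A $ k $ l \<le> 0"
    and v: "\<And>k. v $ k > 0" and Av: "\<And>k. (A *v v) $ k > 0"
    and Ax: "\<And>k. (A *v x) $ k \<ge> 0"
  shows "x $ k \<ge> 0"
proof (rule ccontr)
  assume neg: "\<not> x $ k \<ge> 0"
  define m where "m = Min (range (\<lambda>l. x $ l / v $ l))"
  have "m \<in> range (\<lambda>l. x $ l / v $ l)"
    unfolding m_def by (rule Min_in) auto
  then obtain k0 where k0: "m = x $ k0 / v $ k0" by auto
  have m_le: "m * v $ l \<le> x $ l" for l
  proof -
    have "m \<le> x $ l / v $ l"
      unfolding m_def by (rule Min_le) auto
    then show ?thesis using v[of l] by (simp add: field_simps)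
  qed
  have "m < 0"
    using m_le[of k] neg v[of k] by (smt (verit) mult_nonneg_nonneg)
  have "A $ k0 $ l * x $ l \<le> m * (A $ k0 $ l * v $ l)" for l
  proof (cases "l = k0")
    case True
    then show ?thesis using k0 v[of k0] by simp
  next
    case False
    then show ?thesis
      using mult_left_mono_neg[OF m_le[of l] off[of k0 l]] by (simp add: algebra_simps)
  qed
  then have "(A *v x) $ k0 \<le> m * (A *v v) $ k0"
    unfolding matrix_vector_mult_def by (simp add: sum_distrib_left sum_mono)
  also have "\<dots> < 0"
    using \<open>m < 0\<close> Av[of k0] by (simp add: mult_neg_pos)
  finally show False using Ax[of k0] by simp
qed

text \<open>The minimum principle applied to both \<open>x\<close> and \<open>- x\<close> shows that
  the kernel is trivial.\<close>

lemma z_matrix_invertible: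
  fixes A :: "real^'n^'n"
  assumes off: "\<And>k l. k \<noteq> l \<Longrightarrow> A $ k $ l \<le> 0"
    and v: "\<And>k. v $ k > 0" and Av: "\<And>k. (A *v v) $ k > 0"
  shows "invertible A"
proof -
  have "x = 0" if "A *v x = 0" for x
  proof -
    have "x $ k \<ge> 0" "(- x) $ k \<ge> 0" for k
      using z_matrix_nonneg[OF off v Av, of x] z_matrix_nonneg[OF off v Av, of "- x"] that
      by (simp_all add: vec.neg)
    then show ?thesis by (simp add: vec_eq_iff antisym)
  qed
  then show ?thesis
    by (simp add: invertible_left_inverse matrix_left_invertible_ker)
qed

lemma matrix_mult_matrix_inv:
  assumes "invertible A"
  shows "A ** matrix_inv A = mat 1" and "matrix_inv A ** A = mat 1"
  using someI_ex[OF assms[unfolded invertible_def]] by (simp_all add: matrix_inv_def)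

lemma matrix_vector_mult_matrix_inv:
  fixes A :: "real^'n^'n"
  assumes "invertible A"
  shows "A *v (matrix_inv A *v x) = x"
  using matrix_mult_matrix_inv(1)[OF assms] by (simp add: matrix_vector_mul_assoc)

lemma continuous_on_det:
  fixes A :: "'a::topological_space \<Rightarrow> real^'n^'n"
  assumes "\<And>i j. continuous_on S (\<lambda>t. A t $ i $ j)"
  shows "continuous_on S (\<lambda>t. det (A t))"
  unfolding det_def by (intro continuous_intros assms)

text \<open>The solution \<open>v t\<close> of \<open>(I - t A) v = 1\<close> depends continuously on \<open>t\<close>, since no \<open>1 / t \<ge> 1\<close>
  is an eigenvalue. While it is non-negative it is at least \<open>1\<close>, so it cannot change sign
  between \<open>t = 0\<close> and \<open>t = 1\<close>.\<close>

lemma nonneg_matrix_positive_subsolution: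
  fixes A :: "real^'n^'n"
  assumes nonneg: "\<And>k l. A $ k $ l \<ge> 0" and rho: "matrix_spectral_radius A < 1"
  obtains v where "\<And>k. v $ k \<ge> 1" and "\<And>k. v $ k = 1 + (A *v v) $ k"
proof -
  define B where "B t = mat 1 - t *\<^sub>R A" for t
  have B_mult: "(B t *v x) $ k = x $ k - t * (A *v x) $ k" for t x k
    by (simp add: B_def matrix_vector_mult_diff_rdistrib scaleR_matrix_vector_assoc[symmetric])
  have det: "det (B t) \<noteq> 0" if t: "t \<in> {0..1}" for t
  proof -
    have "x = 0" if "B t *v x = 0" for x
    proof (rule ccontr)
      assume x: "x \<noteq> 0"
      have eq: "x $ k = t * (A *v x) $ k" for k
        using B_mult[of t x k] that by simp
      then have "t \<noteq> 0"
        using x by (auto simp: vec_eq_iff)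
      then have "A *v x = (1 / t) *s x"
        using eq by (simp add: vec_eq_iff)
      then have "1 / t \<le> matrix_spectral_radius A"
        using x by (rule real_eigenvalue_le_spectral_radius)
      moreover have "1 / t \<ge> 1"
        using t \<open>t \<noteq> 0\<close> by simp
      ultimately show False using rho by simp
    qed
    then have "invertible (B t)"
      by (simp add: invertible_left_inverse matrix_left_invertible_ker)
    then show ?thesis by (simp add: invertible_det_nz)
  qed
  \<comment> \<open>Cramer's rule: the determinants are continuous in \<open>t\<close> and the
    denominator does not vanish on the unit interval, so continuity of the solution is
    explicit.\<close>
  define v where "v t = (\<chi> k. det (\<chi> i j. if j = k then 1 else B t $ i $ j) / det (B t))" for t
  have "B t *v v t = vec 1" if "t \<in> {0..1}" for t
    using cramer[OF det[OF that], of "v t" "vec 1"] by (simp add: v_def cong: if_cong)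
  then have v: "v t $ k = 1 + t * (A *v v t) $ k" if "t \<in> {0..1}" for t k
    using B_mult[of t "v t" k] that by simp
  have cont_B: "continuous_on {0..1} (\<lambda>t. B t $ i $ j)" for i j
    unfolding B_def by (simp, intro continuous_intros)
  have cont: "continuous_on {0..1} v"
    unfolding v_def
  proof (intro continuous_intros ballI)
    show "continuous_on {0..1} (\<lambda>t. det (B t))"
      by (intro continuous_on_det cont_B)
    have "continuous_on {0..1} (\<lambda>t. (\<chi> i j. if j = k then 1 else B t $ i $ j) $ i $ j)" for i j k
      by (cases "j = k") (simp_all add: cont_B)
    then show "continuous_on {0..1} (\<lambda>t. det (\<chi> i j. if j = k then 1 else B t $ i $ j))" for k
      by (rule continuous_on_det)
  qed (use det in auto)
  have ge1: "v t $ k \<ge> 1" if "t \<in> {0..1}" "\<forall>l. v t $ l \<ge> 0" for t k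
  proof -
    have "(A *v v t) $ k \<ge> 0"
      using nonneg that by (simp add: matrix_vector_mult_def sum_nonneg)
    then show ?thesis using v[of t k] that by simp
  qed
  let ?T = "{t \<in> {0..1::real}. \<forall>l. v t $ l \<ge> 0}"
  have "closedin (top_of_set {0..1}) ({0..1} \<inter> v -` {x. \<forall>l. x $ l \<in> {0..}})"
    by (intro continuous_closedin_preimage cont closed_vector_box) auto
  moreover have "{0..1} \<inter> v -` {x. \<forall>l. x $ l \<in> {0..}} = ?T"
    by auto
  moreover have "openin (top_of_set {0..1}) ({0..1} \<inter> v -` {x. \<forall>l. x $ l \<in> {0<..}})"
    by (intro continuous_openin_preimage_gen cont open_vector_box) auto
  \<comment> \<open>By \<open>ge1\<close>, non-negative solutions are strictly positive, so the
    closed and the open condition cut out the same set \<open>?T\<close>.\<close>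
  moreover have "{0..1} \<inter> v -` {x. \<forall>l. x $ l \<in> {0<..}} = ?T"
    using ge1 by (auto intro: less_imp_le) (smt (verit) atLeastAtMost_iff)
  moreover have "connected {0..1::real}" by simp
  ultimately have "?T = {} \<or> ?T = {0..1}"
    unfolding connected_clopen by metis
  moreover have "0 \<in> ?T"
    using v[of 0] by simp
  ultimately have "?T = {0..1}" by blast
  then have "1 \<in> ?T" by simp
  then show thesis
    using that[of "v 1"] ge1[of 1] v[of 1] by simp
qed

section \<open>Strongly convex functions of one variable\<close>

text \<open>The first-order lower bounds at the intermediate point \<open>z\<close> are averaged
  with weights \<open>1 - t\<close> and \<open>t\<close>; the linear terms cancel.\<close>

lemma strongly_convex_on_combination:
  assumes f: "strongly_convex_on S m f" and S: "convex S" "x \<in> S" "y \<in> S" and t: "0 \<le> t" "t \<le> 1"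
  shows "f ((1 - t) * x + t * y) \<le> (1 - t) * f x + t * f y - m / 2 * t * (1 - t) * (y - x)\<^sup>2"
proof -
  define z where "z = (1 - t) * x + t * y"
  define d where "d = deriv_within S f z"
  have z: "z \<in> S"
    using convexD[OF S, of "1 - t" t] t by (simp add: z_def)
  have "x - z = - t * (y - x)" "y - z = (1 - t) * (y - x)"
    by (simp_all add: z_def algebra_simps)
  then have "f x \<ge> f z + d * (- t * (y - x)) + m / 2 * (- t * (y - x))\<^sup>2"
    and "f y \<ge> f z + d * ((1 - t) * (y - x)) + m / 2 * ((1 - t) * (y - x))\<^sup>2"
    using f z S unfolding strongly_convex_on_def d_def by (metis power2_abs)+
  then have "(1 - t) * f x + t * f y \<ge>
      (1 - t) * (f z + d * (- t * (y - x)) + m / 2 * (- t * (y - x))\<^sup>2) +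
      t * (f z + d * ((1 - t) * (y - x)) + m / 2 * ((1 - t) * (y - x))\<^sup>2)"
    using t by (intro add_mono mult_left_mono) auto
  also have "(1 - t) * (f z + d * (- t * (y - x)) + m / 2 * (- t * (y - x))\<^sup>2) +
      t * (f z + d * ((1 - t) * (y - x)) + m / 2 * ((1 - t) * (y - x))\<^sup>2) =
      f z + m / 2 * t * (1 - t) * (y - x)\<^sup>2"
    by (simp add: field_simps power2_eq_square)
  finally show ?thesis by (simp add: z_def)
qed

text \<open>The sum of the two strong convexity inequalities based at \<open>x\<close> and at
  \<open>y\<close>.\<close>

lemma strongly_convex_on_deriv_mono:
  assumes f: "strongly_convex_on S m f" and S: "x \<in> S" "y \<in> S"
  shows "m * (y - x)\<^sup>2 \<le> (deriv_within S f y - deriv_within S f x) * (y - x)"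
proof -
  have "f y \<ge> f x + deriv_within S f x * (y - x) + m / 2 * (y - x)\<^sup>2"
    and "f x \<ge> f y + deriv_within S f y * (x - y) + m / 2 * (y - x)\<^sup>2"
    using f S unfolding strongly_convex_on_def by (metis power2_abs power2_commute)+
  then show ?thesis by (simp add: algebra_simps)
qed

lemma strongly_convex_on_deriv_strict_mono:
  assumes f: "strongly_convex_on S m f" and "m > 0" and S: "x \<in> S" "y \<in> S" "x < y"
  shows "deriv_within S f x < deriv_within S f y"
proof -
  have "0 < m * (y - x)\<^sup>2" using assms by simp
  also have "\<dots> \<le> (deriv_within S f y - deriv_within S f x) * (y - x)"
    by (rule strongly_convex_on_deriv_mono[OF f S(1,2)])
  finally show ?thesis using S(3) by (simp add: zero_less_mult_iff)
qed

lemma has_vector_derivative_deriv_within: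
  assumes "f differentiable_on S" and "x \<in> S"
  shows "(f has_vector_derivative deriv_within S f x) (at x within S)"
  using assms unfolding deriv_within_def differentiable_on_def
  by (simp add: vector_derivative_works)

lemma has_real_derivative_deriv_within:
  assumes "f differentiable_on S" and "x \<in> interior S"
  shows "(f has_real_derivative deriv_within S f x) (at x)"
  using has_vector_derivative_deriv_within[OF assms(1), of x] assms(2) interior_subset[of S]
    at_within_interior[OF assms(2)]
  by (auto simp: has_real_derivative_iff_has_vector_derivative)

text \<open>Strong monotonicity bounds every difference quotient of the derivative below by
  \<open>m\<close>, and the limit inherits the bound. The nonempty interior makes \<open>x\<close> a
  limit point of \<open>S\<close>, so the one-sided case at an endpoint is covered too.\<close>

lemma strongly_convex_on_second_deriv_ge:
  assumes f: "strongly_convex_on S m f" and diff: "deriv_within S f differentiable_on S"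
    and S: "convex S" "interior S \<noteq> {}" "x \<in> S"
  shows "m \<le> deriv_within S (deriv_within S f) x"
proof (rule tendsto_lowerbound)
  let ?g = "deriv_within S f"
  have "(?g has_real_derivative deriv_within S ?g x) (at x within S)"
    using has_vector_derivative_deriv_within[OF diff S(3)]
    by (simp add: has_real_derivative_iff_has_vector_derivative)
  then show "((\<lambda>y. (?g y - ?g x) / (y - x)) \<longlongrightarrow> deriv_within S ?g x) (at x within S)"
    by (simp add: has_field_derivative_iff)
  have "m \<le> (?g y - ?g x) / (y - x)" if y: "y \<in> S" "y \<noteq> x" for y
  proof -
    have "m * (y - x)\<^sup>2 \<le> (?g y - ?g x) / (y - x) * (y - x)\<^sup>2"
      using strongly_convex_on_deriv_mono[OF f S(3) y(1)] y(2) by (simp add: power2_eq_square)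
    moreover have "(y - x)\<^sup>2 > 0" using y(2) by simp
    ultimately show ?thesis by (simp only: mult_le_cancel_right_pos)
  qed
  then show "\<forall>\<^sub>F y in at x within S. m \<le> (?g y - ?g x) / (y - x)"
    by (auto simp: eventually_at_filter)
  have "x islimpt S"
  proof (rule connected_imp_perfect[OF convex_connected[OF S(1)] S(3)])
    show "S \<noteq> {z}" for z
      using S(2) by auto
  qed
  then show "at x within S \<noteq> bot"
    by (simp add: trivial_limit_within)
qed

text \<open>The segment between two interior points stays in the interior, where derivatives
  relative to \<open>S\<close> are ordinary ones.\<close>

lemma deriv_within_mean_value:
  assumes diff: "g differentiable_on S" and S: "convex S" "x \<in> interior S" "y \<in> interior S"
  shows "\<exists>z\<in>S. g y - g x = deriv_within S g z * (y - x)"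
proof -
  have *: "\<exists>z\<in>S. g q - g p = deriv_within S g z * (q - p)"
    if pq: "p < q" "p \<in> interior S" "q \<in> interior S" for p q
  proof -
    have sub: "{p..q} \<subseteq> interior S"
      using closed_segment_subset[OF pq(2,3) convex_interior[OF S(1)]] pq(1)
      by (simp add: closed_segment_eq_real_ivl)
    have "\<And>z. p \<le> z \<Longrightarrow> z \<le> q \<Longrightarrow> (g has_real_derivative deriv_within S g z) (at z)"
      using sub by (intro has_real_derivative_deriv_within diff) auto
    from MVT2[OF pq(1) this] obtain z where
      "p < z" "z < q" "g q - g p = (q - p) * deriv_within S g z" by blast
    moreover from this have "z \<in> S"
      using subsetD[OF sub, of z] interior_subset[of S] by auto
    ultimately show ?thesis by (auto simp: mult.commute)
  qed
  consider "x < y" | "y < x" | "x = y" by linarith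
  then show ?thesis
  proof cases
    case 2
    then obtain z where "z \<in> S" "g x - g y = deriv_within S g z * (x - y)"
      using *[of y x] S by blast
    then show ?thesis by (intro bexI[of _ z]) (simp_all add: algebra_simps)
  next
    case 3
    then show ?thesis using S(2) interior_subset[of S] by auto
  qed (use * S in blast)
qed

section \<open>Best replies as maximizers of a linear function minus a strongly convex one\<close>

text \<open>The slope \<open>s\<close> stands for the marginal value of consumption, which is fixed
  once the price and the other consumers' actions are given.\<close>

definition tilted_maximizer :: "real set \<Rightarrow> (real \<Rightarrow> real) \<Rightarrow> real \<Rightarrow> real \<Rightarrow> bool" where
  "tilted_maximizer S f s y \<longleftrightarrow> y \<in> S \<and> (\<forall>z\<in>S. s * z - f z \<le> s * y - f y)"

lemma tilted_maximizer_exists: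
  assumes S: "closed S" "S \<noteq> {}" and f: "continuous_on S f" "strongly_convex_on S m f" and m: "m > 0"
  shows "\<exists>y. tilted_maximizer S f s y"
proof -
  obtain x where x: "x \<in> S" using S(2) by auto
  define d where "d = deriv_within S f x"
  \<comment> \<open>Beyond distance \<open>R\<close> from \<open>x\<close> the quadratic gain
    \<open>m / 2 * r^2\<close> exceeds the linear gain \<open>\<bar>s - d\<bar> * r\<close>, so
    points there do no better than \<open>x\<close> itself, and maximizing over a compact set
    suffices.\<close>
  define R where "R = 2 * \<bar>s - d\<bar> / m"
  have "R \<ge> 0" using m by (simp add: R_def)
  then have xR: "x \<in> S \<inter> cball x R" using x by simp
  moreover have "compact (S \<inter> cball x R)"
    using S(1) by (simp add: closed_Int_compact)
  moreover have "continuous_on (S \<inter> cball x R) (\<lambda>z. s * z - f z)"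
    by (intro continuous_intros continuous_on_subset[OF f(1)]) auto
  ultimately obtain y where y: "y \<in> S \<inter> cball x R"
    "\<And>z. z \<in> S \<inter> cball x R \<Longrightarrow> s * z - f z \<le> s * y - f y"
    using continuous_attains_sup[of "S \<inter> cball x R" "\<lambda>z. s * z - f z"] by blast
  have "s * z - f z \<le> s * y - f y" if z: "z \<in> S" "z \<notin> cball x R" for z
  proof -
    have "R < \<bar>z - x\<bar>" using z(2) by (simp add: dist_real_def abs_minus_commute)
    then have "2 * \<bar>s - d\<bar> \<le> m * \<bar>z - x\<bar>"
      using m by (simp add: R_def field_simps)
    then have "2 * \<bar>s - d\<bar> * \<bar>z - x\<bar> \<le> m * \<bar>z - x\<bar> * \<bar>z - x\<bar>"
      by (intro mult_right_mono) auto
    then have "(s - d) * (z - x) \<le> m / 2 * \<bar>z - x\<bar>\<^sup>2"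
      using abs_ge_self[of "(s - d) * (z - x)"] by (simp add: abs_mult power2_eq_square)
    moreover have "f z \<ge> f x + d * (z - x) + m / 2 * \<bar>z - x\<bar>\<^sup>2"
      using f(2) x z unfolding strongly_convex_on_def d_def by blast
    ultimately have "s * z - f z \<le> s * x - f x"
      by (simp add: algebra_simps)
    also have "\<dots> \<le> s * y - f y" using y(2) xR .
    finally show ?thesis .
  qed
  then show ?thesis using y unfolding tilted_maximizer_def by blast
qed

text \<open>The maximizer is compared with \<open>(1 - t) * y + t * z\<close>; after division by
  \<open>t\<close>, letting \<open>t\<close> tend to 0 recovers the full constant
  \<open>m / 2\<close>. No derivative at \<open>y\<close> is used, so \<open>y\<close> may be an
  endpoint.\<close>

lemma tilted_maximizer_growth:
  assumes y: "tilted_maximizer S f s y" and z: "z \<in> S"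
    and S: "convex S" and f: "strongly_convex_on S m f"
  shows "s * z - f z + m / 2 * (z - y)\<^sup>2 \<le> s * y - f y"
proof -
  have yS: "y \<in> S" using y by (simp add: tilted_maximizer_def)
  define q where "q = s * y - f y - (s * z - f z)"
  have "m / 2 * (1 - t) * (z - y)\<^sup>2 \<le> q" if t: "0 < t" "t < 1" for t
  proof -
    have "(1 - t) * y + t * z \<in> S"
      using convexD[OF S yS z, of "1 - t" t] t by simp
    then have "s * ((1 - t) * y + t * z) - f ((1 - t) * y + t * z) \<le> s * y - f y"
      using y by (simp add: tilted_maximizer_def)
    moreover have "f ((1 - t) * y + t * z) \<le>
        (1 - t) * f y + t * f z - m / 2 * t * (1 - t) * (z - y)\<^sup>2"
      using t by (intro strongly_convex_on_combination[OF f S yS z]) auto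
    ultimately have "t * (m / 2 * (1 - t) * (z - y)\<^sup>2) \<le> t * q"
      by (simp add: q_def algebra_simps)
    then show ?thesis using t by (simp only: mult_le_cancel_left_pos)
  qed
  then have "\<forall>\<^sub>F t in at_right 0. m / 2 * (1 - t) * (z - y)\<^sup>2 \<le> q"
    using eventually_at_right_real[of 0 1] by (auto elim: eventually_mono)
  moreover have "((\<lambda>t. m / 2 * (1 - t) * (z - y)\<^sup>2) \<longlongrightarrow> m / 2 * (1 - 0) * (z - y)\<^sup>2) (at_right 0)"
    by (intro tendsto_intros)
  ultimately have "m / 2 * (1 - 0) * (z - y)\<^sup>2 \<le> q"
    by (intro tendsto_upperbound) auto
  then show ?thesis by (simp add: q_def)
qed

text \<open>Quadratic growth at each maximizer is tested at the other one; in the sum the values of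
  \<open>f\<close> cancel.\<close>

lemma tilted_maximizer_lipschitz:
  assumes y: "tilted_maximizer S f s y" "tilted_maximizer S f s' y'"
    and S: "convex S" and f: "strongly_convex_on S m f"
  shows "m * \<bar>y - y'\<bar> \<le> \<bar>s - s'\<bar>"
proof (cases "y = y'")
  case False
  have "s * y' - f y' + m / 2 * (y' - y)\<^sup>2 \<le> s * y - f y"
    and "s' * y - f y + m / 2 * (y - y')\<^sup>2 \<le> s' * y' - f y'"
    using tilted_maximizer_growth[OF y(1) _ S f, of y'] tilted_maximizer_growth[OF y(2) _ S f, of y] y
    unfolding tilted_maximizer_def by blast+
  then have "m * (y - y')\<^sup>2 \<le> (s - s') * (y - y')"
    by (simp add: power2_commute[of y' y]) (simp add: algebra_simps)
  also have "\<dots> \<le> \<bar>s - s'\<bar> * \<bar>y - y'\<bar>"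
    by (metis abs_ge_self abs_mult)
  finally have "(m * \<bar>y - y'\<bar>) * \<bar>y - y'\<bar> \<le> \<bar>s - s'\<bar> * \<bar>y - y'\<bar>"
    by (simp add: power2_eq_square mult.assoc)
  then show ?thesis using False by simp
qed simp

lemma tilted_maximizer_first_order:
  assumes y: "tilted_maximizer S f s y" "y \<in> interior S" and f: "f differentiable_on S"
  shows "deriv_within S f y = s"
proof -
  obtain e where e: "e > 0" "ball y e \<subseteq> S"
    using y(2) by (auto simp: mem_interior)
  have "((\<lambda>z. s * z - f z) has_real_derivative s - deriv_within S f y) (at y)"
    by (auto intro!: derivative_eq_intros has_real_derivative_deriv_within f y(2))
  then have "s - deriv_within S f y = 0"
  proof (rule DERIV_local_max[OF _ e(1)], intro allI impI)
    fix z assume "\<bar>y - z\<bar> < e"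
    then have "z \<in> S" using e(2) by (auto simp: dist_real_def)
    then show "s * z - f z \<le> s * y - f y"
      using y(1) by (simp add: tilted_maximizer_def)
  qed
  then show ?thesis by simp
qed

section \<open>Diagonal matrices and interiors of product sets\<close>

lemma diagonal_matrix_mult: "(diagonal_matrix d *v x) $ k = d $ k * x $ k"
  by (simp add: diagonal_matrix_def matrix_vector_mult_def if_distrib[where f = "\<lambda>z. z * _"]
      cong: if_cong)

lemma matrix_inv_diagonal_matrix:
  fixes d :: "real^'n"
  assumes "\<And>k. d $ k \<noteq> 0"
  shows "matrix_inv (diagonal_matrix d) = diagonal_matrix (\<chi> k. 1 / d $ k)"
proof -
  let ?D = "diagonal_matrix d" and ?E = "diagonal_matrix (\<chi> k. 1 / d $ k)"
  have "?E ** ?D = mat 1"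
    using assms
    by (simp add: matrix_eq vec_eq_iff matrix_vector_mul_assoc[symmetric] diagonal_matrix_mult)
  moreover from this have "invertible ?D"
    by (auto simp: invertible_left_inverse)
  then have "?D ** matrix_inv ?D = mat 1"
    by (rule matrix_mult_matrix_inv)
  ultimately show ?thesis
    by (metis matrix_mul_assoc matrix_mul_lid matrix_mul_rid)
qed

lemma norm_axis: "norm (axis k c :: real^'n) = \<bar>c\<bar>"
  by (simp add: norm_eq_sqrt_inner inner_axis_axis)

lemma interior_profilesD:
  assumes "x \<in> interior (profiles X)"
  shows "x $ k \<in> interior (X k)"
proof -
  obtain e where e: "e > 0" "ball x e \<subseteq> profiles X"
    using assms by (auto simp: mem_interior)
  have "ball (x $ k) e \<subseteq> X k"
  proof
    fix y assume y: "y \<in> ball (x $ k) e"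
    have "dist x (x + axis k (y - x $ k)) = \<bar>y - x $ k\<bar>"
      by (simp add: dist_norm norm_axis)
    then have "x + axis k (y - x $ k) \<in> profiles X"
      using y e(2) by (auto simp: dist_real_def abs_minus_commute)
    then have "(x + axis k (y - x $ k)) $ k \<in> X k"
      unfolding profiles_def by blast
    then show "y \<in> X k" by simp
  qed
  then show ?thesis using e(1) by (auto simp: mem_interior)
qed

lemma diagonal_minus_scaleR_mult:
  "((diagonal_matrix d - c *\<^sub>R A) *v z) $ k = d $ k * z $ k - c * (\<Sum>l\<in>UNIV. A $ k $ l * z $ l)"
  by (simp add: matrix_vector_mult_diff_rdistrib diagonal_matrix_mult
      scaleR_matrix_vector_assoc[symmetric]) (simp add: matrix_vector_mult_def)

section \<open>Existence, uniqueness and first-order conditions of the equilibrium\<close>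

definition marginal_value ::
  "real \<Rightarrow> real^'n^'n \<Rightarrow> real^'n \<Rightarrow> real^'n \<Rightarrow> real^'n \<Rightarrow> real^'n \<Rightarrow> 'n \<Rightarrow> real"
where
  "marginal_value \<delta> G a b p x k = a $ k - b $ k * p $ k + \<delta> * (\<Sum>l\<in>UNIV. G $ k $ l * x $ l)"

text \<open>With a zero diagonal a deviation leaves the deviator's own marginal value unchanged, so
  the payoff is linear in the own action up to \<open>h k\<close>.\<close>

lemma nash_equilibrium_iff_tilted_maximizer:
  assumes diag: "\<And>k. G $ k $ k = 0"
  shows "nash_equilibrium \<delta> G a b X h p x \<longleftrightarrow>
    (\<forall>k. tilted_maximizer (X k) (h k) (marginal_value \<delta> G a b p x k) (x $ k))"
proof -
  have "(\<Sum>l\<in>UNIV. G $ k $ l * (if l = k then y else x $ l)) = (\<Sum>l\<in>UNIV. G $ k $ l * x $ l)" for k y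
    by (rule sum.cong) (auto simp: diag)
  then show ?thesis
    by (auto simp: nash_equilibrium_def tilted_maximizer_def profiles_def payoff_def marginal_value_def)
qed

text \<open>The weights \<open>v\<close> witness diagonal dominance of \<open>D - \<delta> G\<close>; they exist because the spectral
  radius of \<open>\<delta> D\<^sup>-\<^sup>1 G\<close> is below \<open>1\<close>.\<close>

locale consumer_game =
  fixes \<delta> :: real
    and G :: "real^'n^'n"
    and a b \<mu> v :: "real^'n"
    and X :: "'n \<Rightarrow> real set"
    and h :: "'n \<Rightarrow> real \<Rightarrow> real"
  assumes delta_nonneg: "\<delta> \<ge> 0"
    and G_diag: "\<And>k. G $ k $ k = 0"
    and G_nonneg: "\<And>k l. G $ k $ l \<ge> 0"
    and mu_pos: "\<And>k. \<mu> $ k > 0"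
    and X_closed: "\<And>k. closed (X k)"
    and X_convex: "\<And>k. convex (X k)"
    and X_interior: "\<And>k. interior (X k) \<noteq> {}"
    and h_diff: "\<And>k. h k differentiable_on X k"
    and phi_diff: "\<And>k. phi X h k differentiable_on X k"
    and h_convex: "\<And>k. strongly_convex_on (X k) (\<mu> $ k) (h k)"
    and v_pos: "\<And>k. v $ k > 0"
    and v_dominant: "\<And>k. \<delta> * (\<Sum>l\<in>UNIV. G $ k $ l * v $ l) < \<mu> $ k * v $ k"
begin

abbreviation "demand \<equiv> marginal_value \<delta> G a b"
abbreviation "nash \<equiv> nash_equilibrium \<delta> G a b X h"
abbreviation "J \<equiv> J_matrix \<delta> G X h"

lemmas nash_iff = nash_equilibrium_iff_tilted_maximizer[OF G_diag]

lemma demand_diff_le: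
  "\<bar>demand p x k - demand p y k\<bar> \<le> \<delta> * (\<Sum>l\<in>UNIV. G $ k $ l * \<bar>x $ l - y $ l\<bar>)"
proof -
  have "demand p x k - demand p y k = \<delta> * (\<Sum>l\<in>UNIV. G $ k $ l * (x $ l - y $ l))"
    by (simp add: marginal_value_def algebra_simps sum_subtractf)
  also have "\<bar>\<dots>\<bar> = \<delta> * \<bar>\<Sum>l\<in>UNIV. G $ k $ l * (x $ l - y $ l)\<bar>"
    using delta_nonneg by (simp add: abs_mult)
  also have "\<dots> \<le> \<delta> * (\<Sum>l\<in>UNIV. \<bar>G $ k $ l * (x $ l - y $ l)\<bar>)"
    using delta_nonneg by (intro mult_left_mono sum_abs)
  finally show ?thesis
    using G_nonneg by (simp add: abs_mult)
qed

text \<open>The vector \<open>?d\<close> of componentwise distances satisfies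
  \<open>?K *v ?d \<le> 0\<close> in every component, by the Lipschitz bound on best replies. The
  minimum principle for \<open>- ?d\<close> then forces \<open>?d\<close> to vanish.\<close>

lemma nash_unique:
  assumes "nash p x" and "nash p y"
  shows "x = y"
proof -
  let ?K = "diagonal_matrix \<mu> - \<delta> *\<^sub>R G" and ?d = "\<chi> k. \<bar>x $ k - y $ k\<bar>"
  have K: "(?K *v z) $ k = \<mu> $ k * z $ k - \<delta> * (\<Sum>l\<in>UNIV. G $ k $ l * z $ l)" for z k
    by (rule diagonal_minus_scaleR_mult)
  have "\<mu> $ k * ?d $ k \<le> \<bar>demand p x k - demand p y k\<bar>" for k
    using assms tilted_maximizer_lipschitz[OF _ _ X_convex h_convex]
    by (simp add: nash_iff)
  then have d: "\<mu> $ k * ?d $ k \<le> \<delta> * (\<Sum>l\<in>UNIV. G $ k $ l * ?d $ l)" for k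
    using order_trans[OF _ demand_diff_le[of p x k y]] by simp
  have "(- ?d) $ k \<ge> 0" for k
  proof (rule z_matrix_nonneg[of ?K v])
    show "0 < (?K *v v) $ l" for l
      unfolding K using v_dominant[of l] by simp
    show "0 \<le> (?K *v (- ?d)) $ l" for l
      unfolding K using d[of l] by (simp add: sum_negf)
  qed (use v_pos delta_nonneg G_nonneg in \<open>auto simp: diagonal_matrix_def\<close>)
  then show ?thesis by (simp add: vec_eq_iff)
qed

lemma nash_exists: "\<exists>x. nash p x"
proof -
  have "\<exists>y. tilted_maximizer (X k) (h k) s y" for k s
    using tilted_maximizer_exists[OF X_closed _ _ h_convex mu_pos] X_interior[of k] interior_subset[of "X k"]
      differentiable_imp_continuous_on[OF h_diff] by blast
  then obtain \<beta> where \<beta>: "\<And>k s. tilted_maximizer (X k) (h k) s (\<beta> k s)"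
    by metis
  have lip: "\<mu> $ k * \<bar>\<beta> k s - \<beta> k s'\<bar> \<le> \<bar>s - s'\<bar>" for k s s'
    by (rule tilted_maximizer_lipschitz[OF \<beta> \<beta> X_convex h_convex])
  define T where "T x = (\<chi> k. \<beta> k (demand p x k))" for x
  define gap where "gap k = \<mu> $ k * v $ k - \<delta> * (\<Sum>l\<in>UNIV. G $ k $ l * v $ l)" for k
  have gap_pos: "gap k > 0" for k
    using v_dominant[of k] by (simp add: gap_def)
  \<comment> \<open>The smallest factor for which the dominance slack \<open>C * gap k\<close>
    absorbs the best reply to the zero profile in every component; this makes the box
    \<open>?S\<close> invariant under \<open>T\<close>.\<close>
  define C where "C = Max (range (\<lambda>k. \<mu> $ k * \<bar>T 0 $ k\<bar> / gap k))"
  have C: "\<mu> $ k * \<bar>T 0 $ k\<bar> \<le> C * gap k" for k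
  proof -
    have "\<mu> $ k * \<bar>T 0 $ k\<bar> / gap k \<le> C"
      unfolding C_def by (rule Max_ge) auto
    then show ?thesis using gap_pos[of k] by (simp add: field_simps)
  qed
  have "0 \<le> C * gap k" for k
    using C[of k] mu_pos[of k] by (smt (verit) mult_nonneg_nonneg)
  then have C_nonneg: "C \<ge> 0"
    using gap_pos by (metis zero_le_mult_iff not_less)
  let ?S = "cbox (- C *\<^sub>R v) (C *\<^sub>R v)"
  have S: "x \<in> ?S \<longleftrightarrow> (\<forall>k. \<bar>x $ k\<bar> \<le> C * v $ k)" for x
    by (auto simp: mem_box_cart abs_le_iff minus_le_iff)
  have TS: "T x \<in> ?S" if x: "x \<in> ?S" for x
    unfolding S
  proof
    fix k
    have "\<mu> $ k * \<bar>T x $ k\<bar> \<le> \<mu> $ k * \<bar>T x $ k - T 0 $ k\<bar> + \<mu> $ k * \<bar>T 0 $ k\<bar>"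
      using mu_pos[of k] by (simp add: distrib_left[symmetric])
    also have "\<mu> $ k * \<bar>T x $ k - T 0 $ k\<bar> \<le> \<bar>demand p x k - demand p 0 k\<bar>"
      unfolding T_def by (simp add: lip)
    also have "\<dots> \<le> \<delta> * (\<Sum>l\<in>UNIV. G $ k $ l * \<bar>x $ l\<bar>)"
      using demand_diff_le[of p x k 0] by simp
    also have "\<dots> \<le> \<delta> * (\<Sum>l\<in>UNIV. G $ k $ l * (C * v $ l))"
      using x delta_nonneg G_nonneg unfolding S
      by (intro mult_left_mono sum_mono) auto
    also have "\<dots> = C * (\<delta> * (\<Sum>l\<in>UNIV. G $ k $ l * v $ l))"
      by (simp add: sum_distrib_left algebra_simps)
    also have "\<mu> $ k * \<bar>T 0 $ k\<bar> \<le> C * gap k"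
      by (rule C)
    finally have "\<mu> $ k * \<bar>T x $ k\<bar> \<le> \<mu> $ k * (C * v $ k)"
      by (simp add: gap_def algebra_simps)
    then show "\<bar>T x $ k\<bar> \<le> C * v $ k"
      using mu_pos[of k] by simp
  qed
  have cont_\<beta>: "continuous_on UNIV (\<beta> k)" for k
  proof (rule lipschitz_on_continuous_on)
    show "(1 / \<mu> $ k)-lipschitz_on UNIV (\<beta> k)"
      using lip[of k] mu_pos[of k]
      by (intro lipschitz_onI) (auto simp: dist_real_def field_simps)
  qed
  have "continuous_on UNIV T"
    unfolding T_def marginal_value_def
    by (intro continuous_intros continuous_on_compose2[OF cont_\<beta>]) auto
  then have "continuous_on ?S T"
    by (rule continuous_on_subset) simp
  moreover have "0 \<in> ?S"
    unfolding S using C_nonneg v_pos by (simp add: less_imp_le)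
  ultimately obtain x where x: "T x = x"
    using brouwer[of ?S T] TS by (metis Pi_I compact_cbox convex_box(1) empty_iff)
  have "nash p x"
    unfolding nash_iff
  proof
    fix k
    have "x $ k = \<beta> k (demand p x k)"
      using arg_cong[OF x, of "\<lambda>x. x $ k"] by (simp add: T_def)
    then show "tilted_maximizer (X k) (h k) (demand p x k) (x $ k)"
      using \<beta> by simp
  qed
  then show ?thesis ..
qed

lemma nash_equilibrium_equilibrium: "nash p (equilibrium \<delta> G a b X h p)"
  unfolding equilibrium_def using nash_exists nash_unique by (metis theI)

text \<open>Interiority turns the optimality of each component into an equation.\<close>

lemma phi_equilibrium:
  assumes "equilibrium \<delta> G a b X h p \<in> interior (profiles X)"
  shows "phi X h k (equilibrium \<delta> G a b X h p $ k) = demand p (equilibrium \<delta> G a b X h p) k"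
  using tilted_maximizer_first_order[OF _ interior_profilesD[OF assms] h_diff]
    nash_equilibrium_equilibrium[of p]
  by (simp add: phi_def nash_iff)

section \<open>The Jacobian, its inverse, and the response to a price change\<close>

lemma J_mult:
  "(J x *v z) $ k = deriv_within (X k) (phi X h k) (x $ k) * z $ k - \<delta> * (\<Sum>l\<in>UNIV. G $ k $ l * z $ l)"
  by (simp add: J_matrix_def diagonal_minus_scaleR_mult)

lemma J_off_diagonal: "k \<noteq> l \<Longrightarrow> J x $ k $ l \<le> 0"
  using delta_nonneg G_nonneg by (simp add: J_matrix_def diagonal_matrix_def)

text \<open>Second derivatives are at least the strong convexity constants, so the weights
  \<open>v\<close> serve all profiles at once, with a slack independent of \<open>x\<close>.\<close>

lemma J_dominant:
  assumes "x \<in> profiles X"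
  shows "(J x *v v) $ k \<ge> \<mu> $ k * v $ k - \<delta> * (\<Sum>l\<in>UNIV. G $ k $ l * v $ l)"
proof -
  have "\<mu> $ k \<le> deriv_within (X k) (phi X h k) (x $ k)"
    using strongly_convex_on_second_deriv_ge[OF h_convex _ X_convex X_interior, of k "x $ k"]
      phi_diff[of k] assms by (simp add: phi_def profiles_def)
  then show ?thesis
    using v_pos[of k] by (simp add: J_mult)
qed

lemma J_dominant_pos: "x \<in> profiles X \<Longrightarrow> (J x *v v) $ k > 0"
  using J_dominant[of x k] v_dominant[of k] by linarith

lemma J_invertible: "x \<in> profiles X \<Longrightarrow> invertible (J x)"
  by (rule z_matrix_invertible[OF J_off_diagonal v_pos J_dominant_pos])

lemma J_inverse_column_nonneg:
  assumes "x \<in> profiles X"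
  shows "(matrix_inv (J x) *v axis i 1) $ k \<ge> 0"
proof (rule z_matrix_nonneg[OF J_off_diagonal v_pos J_dominant_pos[OF assms]])
  show "0 \<le> (J x *v (matrix_inv (J x) *v axis i 1)) $ l" for l
    by (simp add: matrix_vector_mult_matrix_inv J_invertible assms axis_def)
qed

text \<open>The minimum principle compares column \<open>i\<close> of the inverse with
  \<open>v\<close> divided by the dominance slack of row \<open>i\<close>. The bound does not depend
  on \<open>x\<close>.\<close>

lemma J_inverse_column_le:
  assumes "x \<in> profiles X"
  shows "(matrix_inv (J x) *v axis i 1) $ k \<le>
    v $ k / (\<mu> $ i * v $ i - \<delta> * (\<Sum>l\<in>UNIV. G $ i $ l * v $ l))"
proof -
  define g where "g = \<mu> $ i * v $ i - \<delta> * (\<Sum>l\<in>UNIV. G $ i $ l * v $ l)"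
  have g: "g > 0" using v_dominant[of i] by (simp add: g_def)
  let ?u = "matrix_inv (J x) *v axis i 1"
  have "((1 / g) *s v - ?u) $ k \<ge> 0"
  proof (rule z_matrix_nonneg[OF J_off_diagonal v_pos J_dominant_pos[OF assms]])
    fix l
    have "(J x *v ((1 / g) *s v - ?u)) $ l = (J x *v v) $ l / g - axis i 1 $ l"
      by (simp add: matrix_vector_mult_diff_distrib vec.scale matrix_vector_mult_matrix_inv
          J_invertible assms)
    also have "\<dots> \<ge> 0"
      using J_dominant[OF assms, of i] J_dominant_pos[OF assms, of l] g
      by (auto simp: axis_def g_def[symmetric])
    finally show "0 \<le> (J x *v ((1 / g) *s v - ?u)) $ l" .
  qed
  then show ?thesis by (simp add: g_def)
qed

text \<open>Entry \<open>i\<close> of the row vector in \<open>influential_value\<close> is the sum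
  of column \<open>i\<close> of the inverse. The uniform column bound makes the real supremum a
  genuine upper bound.\<close>

lemma sum_J_inverse_column_le_influential_value:
  assumes "x \<in> profiles X"
  shows "(\<Sum>k\<in>UNIV. (matrix_inv (J x) *v axis i 1) $ k) \<le> influential_value \<delta> G X h i"
proof -
  have eq: "(vec 1 v* matrix_inv (J y)) $ i = (\<Sum>k\<in>UNIV. (matrix_inv (J y) *v axis i 1) $ k)" for y
    by (simp add: vector_matrix_mult_def matrix_vector_mult_basis column_def)
  have "bdd_above ((\<lambda>y. (vec 1 v* matrix_inv (J y)) $ i) ` profiles X)"
    unfolding eq by (rule bdd_aboveI2) (rule sum_mono, rule J_inverse_column_le)
  then have "(vec 1 v* matrix_inv (J x)) $ i \<le> influential_value \<delta> G X h i"
    unfolding influential_value_def using assms by (intro cSUP_upper)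
  then show ?thesis by (simp only: eq)
qed

text \<open>By the mean value theorem in each coordinate, the first-order conditions at two prices
  differ by one Jacobian at an intermediate profile, so the response to a price change is an
  exact solution of a linear system and the revenue need not be differentiated.\<close>

lemma equilibrium_component_le:
  assumes p: "equilibrium \<delta> G a b X h p \<in> interior (profiles X)"
    and q: "equilibrium \<delta> G a b X h (p + axis i t) \<in> interior (profiles X)"
    and t: "t > 0" and b: "b $ i > 0"
    and bounds: "\<And>k. 0 \<le> p $ k" "\<And>k. p $ k \<le> c"
    and le: "revenue \<delta> G a b X h (p + axis i t) \<le> revenue \<delta> G a b X h p"
  shows "equilibrium \<delta> G a b X h (p + axis i t) $ i \<le> c * b $ i * influential_value \<delta> G X h i"
proof -
  define x where "x = equilibrium \<delta> G a b X h p"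
  define y where "y = equilibrium \<delta> G a b X h (p + axis i t)"
  have "\<exists>z\<in>X k. phi X h k (y $ k) - phi X h k (x $ k) =
      deriv_within (X k) (phi X h k) z * (y $ k - x $ k)" for k
    using deriv_within_mean_value[OF phi_diff X_convex] interior_profilesD[OF p]
      interior_profilesD[OF q] by (simp add: x_def y_def)
  then obtain z where z: "\<And>k. z k \<in> X k" "\<And>k. phi X h k (y $ k) - phi X h k (x $ k) =
      deriv_within (X k) (phi X h k) (z k) * (y $ k - x $ k)"
    by metis
  define \<xi> where "\<xi> = vec_lambda z"
  have \<xi>: "\<xi> \<in> profiles X"
    using z(1) by (simp add: \<xi>_def profiles_def)
  define u where "u = matrix_inv (J \<xi>) *v axis i 1"
  \<comment> \<open>The mean-value slopes form the diagonal part of \<open>J \<xi>\<close>, while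
    the interaction term is already linear; only the price of consumer \<open>i\<close> has
    changed.\<close>
  have "J \<xi> *v (y - x) = (- (b $ i * t)) *s axis i 1"
  proof (rule vec_eq_iff[THEN iffD2], rule allI)
    fix k
    have "phi X h k (y $ k) - phi X h k (x $ k) = demand (p + axis i t) y k - demand p x k"
      using phi_equilibrium[OF p] phi_equilibrium[OF q] by (simp add: x_def y_def)
    also have "\<dots> = \<delta> * (\<Sum>l\<in>UNIV. G $ k $ l * (y - x) $ l) - b $ k * axis i t $ k"
      by (simp add: marginal_value_def algebra_simps sum_subtractf)
    finally have "phi X h k (y $ k) - phi X h k (x $ k) =
      \<delta> * (\<Sum>l\<in>UNIV. G $ k $ l * (y - x) $ l) - b $ k * axis i t $ k" .
    then show "(J \<xi> *v (y - x)) $ k = ((- (b $ i * t)) *s axis i 1) $ k"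
      using z(2)[of k] by (simp add: J_mult \<xi>_def axis_def)
  qed
  then have "matrix_inv (J \<xi>) *v (J \<xi> *v (y - x)) = (- (b $ i * t)) *s u"
    by (simp only: vec.scale u_def)
  then have yx: "y - x = (- (b $ i * t)) *s u"
    using matrix_mult_matrix_inv(2)[OF J_invertible[OF \<xi>]] by (simp add: matrix_vector_mul_assoc)
  have "(p + axis i t) \<bullet> y \<le> p \<bullet> x"
    using le by (simp add: revenue_def x_def y_def)
  \<comment> \<open>The extra revenue \<open>t * y $ i\<close> from the higher price cannot exceed
    the loss from reduced demand, valued at the old prices.\<close>
  then have "t * y $ i \<le> - (p \<bullet> (y - x))"
    by (simp add: inner_add_left inner_axis' inner_diff_right)
  also have "\<dots> = t * (b $ i * (p \<bullet> u))"
    unfolding yx by (simp add: scalar_mult_eq_scaleR)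
  finally have "y $ i \<le> b $ i * (p \<bullet> u)"
    using t by simp
  also have "p \<bullet> u \<le> c * (\<Sum>k\<in>UNIV. u $ k)"
    unfolding inner_vec_def sum_distrib_left
    using bounds(2) J_inverse_column_nonneg[OF \<xi>] by (auto intro!: sum_mono mult_right_mono simp: u_def)
  also have "\<dots> \<le> c * influential_value \<delta> G X h i"
    unfolding u_def using order_trans[OF bounds]
    by (intro mult_left_mono sum_J_inverse_column_le_influential_value \<xi>) auto
  finally show ?thesis
    using b by (simp add: y_def algebra_simps)
qed

end

section \<open>The bound on the optimal price\<close>

theorem corollary2:
  fixes \<delta> :: real
    and G :: "real^'n^'n"
    and a b \<mu> pbar pstar :: "real^'n"
    and X :: "'n \<Rightarrow> real set"
    and h :: "'n \<Rightarrow> real \<Rightarrow> real"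
    and i :: 'n
  defines "P \<equiv> {p :: real^'n. \<forall>k. p $ k \<in> {0..pbar $ k}}"
    and "pmax \<equiv> Max (range (\<lambda>k. pbar $ k))"
    and "V \<equiv> influential_value \<delta> G X h i"
  assumes "\<And>k. 0 < pbar $ k"
    and "\<delta> \<ge> 0"
    and "\<And>k. G $ k $ k = 0"
    and "\<And>k. b $ k > 0"
    and "\<And>k. \<mu> $ k > 0"
    and "\<And>k. h k differentiable_on X k"
    and "\<And>k. continuous_on (X k) (phi X h k)"
    and "\<And>k. phi X h k differentiable_on X k"
    and "\<And>k. strongly_convex_on (X k) (\<mu> $ k) (h k)"
    and "(\<forall>k. X k \<subseteq> {0..} \<and> X k \<noteq> {} \<and> convex (X k) \<and> compact (X k)) \<or>
         (\<forall>k. X k \<subseteq> {0..} \<and> X k \<noteq> {} \<and> convex (X k) \<and> closed (X k) \<and>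
              filterlim (\<lambda>x. h k x / \<bar>x\<bar>) at_top (inf at_infinity (principal (X k))))"
    and "\<And>k l. G $ k $ l \<ge> 0"
    and "matrix_spectral_radius (\<delta> *\<^sub>R (matrix_inv (diagonal_matrix \<mu>) ** G)) < 1"
    and "\<And>p. p \<in> P \<Longrightarrow> equilibrium \<delta> G a b X h p \<in> interior (profiles X)"
    and "pstar \<in> interior P"
    and "local_maximizer_on P (revenue \<delta> G a b X h) pstar"
    and "row i G = 0"
  shows "V < phi_inv X h i (a $ i) / (pmax * b $ i) \<longrightarrow>
           pstar $ i \<ge> (a $ i - phi X h i (pmax * b $ i * V)) / b $ i \<and>
           (a $ i - phi X h i (pmax * b $ i * V)) / b $ i > 0"
proof
  let ?eq = "equilibrium \<delta> G a b X h"
  have P: "p \<in> P \<longleftrightarrow> (\<forall>k. 0 \<le> p $ k \<and> p $ k \<le> pbar $ k)" for p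
    by (simp add: P_def)
  \<comment> \<open>The zero price vector serves twice: its interior equilibrium shows that each
    \<open>X k\<close> has nonempty interior, and it locates \<open>a $ i\<close> in the range of
    \<open>phi X h i\<close>.\<close>
  have "0 \<in> P"
    using assms(4) by (simp add: P less_imp_le)
  have mu: "\<mu> $ k > 0" for k by fact
  have X: "X k \<subseteq> {0..} \<and> X k \<noteq> {} \<and> convex (X k) \<and> closed (X k)" for k
    using assms(13) by (auto intro: compact_imp_closed)
  have int: "?eq p $ k \<in> interior (X k)" if "p \<in> P" for p k
    using interior_profilesD assms(16)[OF that] by blast
  let ?M = "\<delta> *\<^sub>R (matrix_inv (diagonal_matrix \<mu>) ** G)"
  have M: "(?M *v z) $ k = \<delta> * (\<Sum>l\<in>UNIV. G $ k $ l * z $ l) / \<mu> $ k" for z k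
  proof -
    have "?M *v z = \<delta> *\<^sub>R (matrix_inv (diagonal_matrix \<mu>) *v (G *v z))"
      by (simp add: scaleR_matrix_vector_assoc matrix_vector_mul_assoc)
    also have "\<dots> $ k = \<delta> * (G *v z) $ k / \<mu> $ k"
      using mu by (subst matrix_inv_diagonal_matrix) (auto simp: diagonal_matrix_mult less_imp_neq[symmetric])
    finally show ?thesis by (simp add: matrix_vector_mult_def)
  qed
  have "?M $ k $ l \<ge> 0" for k l
  proof -
    have "?M $ k $ l = (?M *v axis l 1) $ k"
      by (simp add: matrix_vector_mult_basis column_def)
    also have "\<dots> \<ge> 0"
      unfolding M using mu[of k] \<open>\<delta> \<ge> 0\<close> assms(14)
      by (intro divide_nonneg_pos mult_nonneg_nonneg sum_nonneg) (simp_all add: axis_def)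
    finally show ?thesis .
  qed
  then obtain v where v: "\<And>k. v $ k \<ge> 1" "\<And>k. v $ k = 1 + (?M *v v) $ k"
    using nonneg_matrix_positive_subsolution[of ?M] assms(15) by metis
  interpret consumer_game \<delta> G a b \<mu> v X h
  proof
    show "v $ k > 0" for k using v(1)[of k] by linarith
    \<comment> \<open>From \<open>v = 1 + ?M *v v\<close> the left side equals
      \<open>\<mu> $ k * (v $ k - 1)\<close>.\<close>
    show "\<delta> * (\<Sum>l\<in>UNIV. G $ k $ l * v $ l) < \<mu> $ k * v $ k" for k
      using v(2)[of k] mu[of k] unfolding M by (simp add: field_simps)
    show "interior (X k) \<noteq> {}" for k using int[OF \<open>0 \<in> P\<close>] by blast
  qed (use assms X in auto)
  have row0: "G $ i $ l = 0" for l
    using \<open>row i G = 0\<close> by (simp add: row_def vec_eq_iff)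
  \<comment> \<open>The vanishing row decouples consumer \<open>i\<close>: the first-order condition
    involves only the own price.\<close>
  have phi_eq: "phi X h i (?eq p $ i) = a $ i - b $ i * p $ i" if "p \<in> P" for p
    using phi_equilibrium[OF assms(16)[OF that]] by (simp add: marginal_value_def row0)
  have phi_less: "phi X h i x < phi X h i y" if "x \<in> X i" "y \<in> X i" "x < y" for x y
    unfolding phi_def using strongly_convex_on_deriv_strict_mono[OF h_convex mu_pos that] .
  have "inj_on (phi X h i) (X i)"
    by (rule linorder_inj_onI) (use phi_less in \<open>auto simp: less_le\<close>)
  \<comment> \<open>At price 0 the first-order condition reads
    \<open>phi X h i (?eq 0 $ i) = a $ i\<close>, so \<open>inv_into\<close> is evaluated on the
    range and is a true inverse there.\<close>
  then have inv: "phi_inv X h i (a $ i) = ?eq 0 $ i"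
    using inv_into_f_f[of "phi X h i" "X i" "?eq 0 $ i"] phi_eq[OF \<open>0 \<in> P\<close>]
      int[OF \<open>0 \<in> P\<close>] interior_subset unfolding phi_inv_def by auto
  have pmax: "pbar $ k \<le> pmax" for k
    unfolding pmax_def by (rule Max_ge) auto
  have pmax_pos: "pmax > 0"
    using pmax[of i] assms(4)[of i] by linarith
  have b: "b $ i > 0" by fact
  define w where "w = pmax * b $ i * V"
  assume "V < phi_inv X h i (a $ i) / (pmax * b $ i)"
  then have w: "w < ?eq 0 $ i"
    using pmax_pos b by (simp add: inv w_def field_simps)
  obtain e1 where e1: "e1 > 0" "ball pstar e1 \<subseteq> P"
    using \<open>pstar \<in> interior P\<close> by (auto simp: mem_interior)
  obtain e2 where e2: "e2 > 0" "\<And>q. q \<in> P \<Longrightarrow> dist q pstar < e2 \<Longrightarrow>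
      revenue \<delta> G a b X h q \<le> revenue \<delta> G a b X h pstar" and pP: "pstar \<in> P"
    using assms(18) unfolding local_maximizer_on_def by blast
  define e where "e = min e1 e2"
  have e: "e > 0" using e1 e2 by (simp add: e_def)
  \<comment> \<open>For \<open>t\<close> below \<open>e\<close> the raised price stays both in
    \<open>P\<close> and in the neighbourhood where \<open>pstar\<close> is optimal.\<close>
  have step: "w \<in> X i \<and> a $ i - b $ i * (pstar $ i + t) \<le> phi X h i w" if t: "0 < t" "t < e" for t
  proof -
    let ?q = "pstar + axis i t"
    have d: "dist ?q pstar = t" using t by (simp add: dist_norm norm_axis)
    then have q: "?q \<in> P"
      using e1 t by (auto simp: e_def dist_commute)
    have "?eq ?q $ i \<le> pmax * b $ i * influential_value \<delta> G X h i"
    proof (rule equilibrium_component_le[OF assms(16)[OF pP] assms(16)[OF q] t(1) b])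
      show "0 \<le> pstar $ k" "pstar $ k \<le> pmax" for k
        using pP pmax[of k] unfolding P by (auto intro: order_trans)
      show "revenue \<delta> G a b X h ?q \<le> revenue \<delta> G a b X h pstar"
        using e2(2)[OF q] d t by (simp add: e_def)
    qed
    then have le: "?eq ?q $ i \<le> w" by (simp add: w_def V_def)
    have mem: "?eq ?q $ i \<in> X i" "?eq 0 $ i \<in> X i"
      using int[OF q] int[OF \<open>0 \<in> P\<close>] interior_subset by blast+
    \<comment> \<open>\<open>w\<close> lies between two equilibrium demands of consumer
      \<open>i\<close>. Membership in the interval matters because monotonicity of
      \<open>phi X h i\<close> is known only there.\<close>
    have wX: "w \<in> X i"
      using closed_segment_subset[OF mem X_convex] le w
      by (auto simp: closed_segment_eq_real_ivl)
    have "phi X h i (?eq ?q $ i) \<le> phi X h i w"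
      using phi_less[OF mem(1) wX] le by (cases "?eq ?q $ i = w") auto
    then show ?thesis using phi_eq[OF q] wX by simp
  qed
  have wX: "w \<in> X i"
    using step[of "e / 2"] e by simp
  have "phi X h i w < a $ i"
    using phi_less[OF wX _ w] int[OF \<open>0 \<in> P\<close>] interior_subset[of "X i"] phi_eq[OF \<open>0 \<in> P\<close>] by auto
  \<comment> \<open>The limit \<open>t\<close> to 0 needs no continuity of the equilibrium, since
    \<open>w\<close> does not depend on \<open>t\<close>.\<close>
  moreover have "a $ i - b $ i * pstar $ i \<le> phi X h i w"
  proof (rule tendsto_upperbound)
    have "((\<lambda>t. a $ i - b $ i * (pstar $ i + t)) \<longlongrightarrow> a $ i - b $ i * (pstar $ i + 0)) (at_right 0)"
      by (intro tendsto_intros)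
    then show "((\<lambda>t. a $ i - b $ i * (pstar $ i + t)) \<longlongrightarrow> a $ i - b $ i * pstar $ i) (at_right 0)"
      by simp
    show "\<forall>\<^sub>F t in at_right 0. a $ i - b $ i * (pstar $ i + t) \<le> phi X h i w"
      using eventually_at_right_real[OF e] step by (auto elim: eventually_mono)
  qed simp
  ultimately show "pstar $ i \<ge> (a $ i - phi X h i (pmax * b $ i * V)) / b $ i \<and>
      (a $ i - phi X h i (pmax * b $ i * V)) / b $ i > 0"
    using b by (simp add: w_def field_simps)
qed

end
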